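(* For every fixed even positive integer $m$ there exists a constant $C_2(m)>0$ depending only on $m$ such that for every sufficiently large even integer $n$, $$\alpha(m,n)\le C_2(m)\cdot\frac{\binom{m}{m/2}^n}{n^{\frac{m-1}{2}}}.$$
   Context: For positive integers $m,n$, let $A(m,n)$ be the set of all $m\times n$ matrices with every entry in $\{1,-1\}$ such that every row sum and every column sum has absolute value at most $1$, and let $\alpha(m,n)=|A(m,n)|$. *)

theory Defs
  imports Complex_Main "Jordan_Normal_Form.Matrix"
begin

definition near_balanced_mats :: "nat \<Rightarrow> nat \<Rightarrow> int mat set" where
  "near_balanced_mats m n =
    {M \<in> carrier_mat m n.
       (\<forall>i<m. \<forall>j<n. M $$ (i, j) \<in> {1, -1}) \<and>
       (\<forall>i<m. \<bar>\<Sum>j<n. M $$ (i, j)\<bar> \<le> 1) \<and>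
       (\<forall>j<n. \<bar>\<Sum>i<m. M $$ (i, j)\<bar> \<le> 1)}"

definition alpha :: "nat \<Rightarrow> nat \<Rightarrow> nat" where
  "alpha m n = card (near_balanced_mats m n)"

end

theory Submission
  imports Defs "HOL-Combinatorics.Transposition" "HOL-Analysis.Convex"
begin

text \<open>
  For even \<open>m\<close> and \<open>n\<close>, \<open>\<alpha>(m,n)\<close> counts the \<open>n\<close>-tuples of half-size subsets of the rows in which
  every row is covered \<open>n/2\<close> times. Put \<open>d = m - 1\<close>, and in each column \<open>j\<close> with \<open>j mod d = k\<close>
  exchange the rows \<open>k\<close> and \<open>k + 1\<close> or not, according to a fair coin; this preserves the uniform
  distribution on the tuples. The number of \<open>+1\<close> entries in the first \<open>k + 1\<close> rows is affected only
  by the exchanges in block \<open>k\<close>, so the \<open>d\<close> balance conditions become independent signed sums of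
  coins, one per block. A block with \<open>N\<close> columns changed by the exchange contributes a probability of
  at most \<open>1 / sqrt (N + 1)\<close>. Averaging over the tuples yields a factor of order \<open>n\<^sup>-\<^sup>1\<^sup>/\<^sup>2\<close>
  per block.
\<close>

section \<open>Central binomial coefficients and signed subset sums\<close>

text \<open>From \<open>n\<close> to \<open>Suc n\<close> the left side grows by the factor
  \<open>4 * (2 * n + 3) * (2 * n + 1) / (n + 1)\<^sup>2\<close>, which is below 16 because
  \<open>(2 * n + 3) * (2 * n + 1)\<close> is one less than
  \<open>4 * (n + 1)\<^sup>2\<close>.\<close>

lemma central_binomial_upper_bound: "(2 * n + 1) * (2 * n choose n)\<^sup>2 \<le> 16 ^ n"
proof (induction n)
  case 0
  show ?case by simp
next
  case (Suc n)
  let ?c = "2 * n choose n" and ?d = "2 * Suc n choose Suc n"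
  have rec: "Suc n * ?d = 2 * (2 * n + 1) * ?c"
  proof -
    have "Suc n * ?d = Suc (2 * n + 1) * (2 * n + 1 choose n)"
      using Suc_times_binomial_eq[of "2 * n + 1" n] by (simp add: mult.commute)
    moreover have "Suc n * (2 * n + 1 choose n) = (2 * n + 1) * ?c"
    proof -
      have "(2 * n + 1 choose n) = (2 * n + 1 choose Suc n)"
        using binomial_symmetric[of n "2 * n + 1"] by simp
      then show ?thesis
        using Suc_times_binomial_eq[of "2 * n" n] by (simp add: mult.commute)
    qed
    ultimately show ?thesis by (simp add: algebra_simps)
  qed
  \<comment> \<open>The factor \<open>(Suc n)\<^sup>2\<close> lets \<open>rec\<close> be applied
    without division in the naturals; it is cancelled at the end.\<close>
  have "(Suc n)\<^sup>2 * ((2 * Suc n + 1) * ?d\<^sup>2) = (2 * n + 3) * (Suc n * ?d)\<^sup>2"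
    by (simp only: power_mult_distrib mult_Suc_right) (simp add: mult_ac del: binomial_Suc_Suc mult_Suc mult_Suc_right)
  also have "\<dots> = 4 * (2 * n + 3) * (2 * n + 1) * ((2 * n + 1) * ?c\<^sup>2)"
  proof -
    have "y * (2 * z * c)\<^sup>2 = 4 * y * z * (z * c\<^sup>2)" for y z c :: nat
      by (simp add: power2_eq_square)
    then show ?thesis unfolding rec .
  qed
  also have "\<dots> \<le> 4 * (2 * n + 3) * (2 * n + 1) * 16 ^ n"
    using Suc.IH by (intro mult_left_mono) auto
  also have "\<dots> \<le> 16 * (Suc n)\<^sup>2 * 16 ^ n"
    by (intro mult_right_mono) (simp_all add: power2_eq_square algebra_simps)
  also have "\<dots> = (Suc n)\<^sup>2 * 16 ^ Suc n"
    by simp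
  finally show ?case by (simp only: mult_le_cancel1) simp
qed

text \<open>The middle coefficient is the largest. For odd \<open>n = 2 * i + 1\<close> it is half
  of the central coefficient of \<open>2 * Suc i\<close>, so both parities reduce to the central
  bound.\<close>

lemma binomial_le_two_power_div_sqrt: "real (n choose k) \<le> 2 ^ n / sqrt (real n + 1)"
proof -
  have "(n + 1) * (n choose (n div 2))\<^sup>2 \<le> 4 ^ n"
  proof (cases "even n")
    case True
    then obtain i where i: "n = 2 * i" by (auto elim: evenE)
    show ?thesis using central_binomial_upper_bound[of i] by (simp add: i power_mult)
  next
    case False
    then obtain i where i: "n = 2 * i + 1" by (auto elim: oddE)
    have "(2 * Suc i choose Suc i) = 2 * (2 * i + 1 choose i)"
      using binomial_symmetric[of i "2 * i + 1"] by simp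
    then have "(2 * i + 3) * (4 * (2 * i + 1 choose i)\<^sup>2) \<le> 16 ^ Suc i"
      using central_binomial_upper_bound[of "Suc i"]
      by (simp add: power_mult_distrib algebra_simps del: binomial_Suc_Suc power_Suc)
    moreover have "(n + 1) * (n choose (n div 2))\<^sup>2 \<le> (2 * i + 3) * (2 * i + 1 choose i)\<^sup>2"
      by (intro mult_mono) (simp_all add: i del: binomial_Suc_Suc)
    moreover have "(16::nat) ^ Suc i = 4 * 4 ^ n"
      by (simp add: i power_mult)
    ultimately show ?thesis by linarith
  qed
  moreover have "(n choose k)\<^sup>2 \<le> (n choose (n div 2))\<^sup>2"
    by (intro power_mono binomial_maximum) simp
  ultimately have "(n + 1) * (n choose k)\<^sup>2 \<le> 4 ^ n"
    by (meson le_trans mult_le_mono2)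
  then have "real ((n + 1) * (n choose k)\<^sup>2) \<le> real (4 ^ n)"
    by (rule of_nat_mono)
  moreover have "((2::real) ^ n)\<^sup>2 = 4 ^ n"
    by (simp add: power2_eq_square flip: power_mult_distrib)
  ultimately have "(sqrt (real n + 1) * real (n choose k))\<^sup>2 \<le> (2 ^ n)\<^sup>2"
    by (simp add: power_mult_distrib algebra_simps)
  then have "sqrt (real n + 1) * real (n choose k) \<le> 2 ^ n"
    by (rule power2_le_imp_le) simp
  then show ?thesis
    by (simp add: field_simps)
qed

text \<open>A Littlewood-Offord estimate for coefficients in {-1, 0, 1}. Indices with coefficient 0
  are free; on the others a prescribed sum becomes a prescribed cardinality, so one binomial
  coefficient counts them.\<close>

lemma card_subsets_sum_eq_le:
  fixes c :: "'a \<Rightarrow> int"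
  assumes "finite J" and c: "\<And>j. j \<in> J \<Longrightarrow> \<bar>c j\<bar> \<le> 1"
  shows "real (card {t \<in> Pow J. sum c t = a})
           \<le> 2 ^ card J / sqrt (real (card {j \<in> J. c j \<noteq> 0}) + 1)"
proof -
  define Z where "Z = {j \<in> J. c j = 0}"
  define P where "P = {j \<in> J. c j = 1}"
  define M where "M = {j \<in> J. c j = -1}"
  define N where "N = {j \<in> J. c j \<noteq> 0}"
  have fin: "finite Z" "finite P" "finite M" "finite N"
    using assms(1) by (auto simp: Z_def P_def M_def N_def)
  have N: "N = P \<union> M" "P \<inter> M = {}" and J: "J = Z \<union> N" "Z \<inter> N = {}"
    using c by (fastforce simp: Z_def P_def M_def N_def)+
  \<comment> \<open>Complementing \<open>t\<close> on the negative part turns the signed sum into a cardinality.\<close>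
  let ?h = "\<lambda>t. (t \<inter> Z, (t \<inter> P) \<union> (M - t))"
  \<comment> \<open>The size comes from
    \<open>sum c t = card (t \<inter> P) - card (t \<inter> M)\<close> and
    \<open>card (M - t) = card M - card (t \<inter> M)\<close>. If \<open>a + int (card M)\<close>
    is negative, no \<open>t\<close> has sum \<open>a\<close>, so truncation by \<open>nat\<close>
    is harmless.\<close>
  let ?U = "{u. u \<subseteq> N \<and> card u = nat (a + int (card M))}"
  have "inj_on ?h (Pow J)"
  proof (rule inj_onI)
    fix s t assume st: "s \<in> Pow J" "t \<in> Pow J" "?h s = ?h t"
    \<comment> \<open>Recovers \<open>t\<close> from \<open>?h t\<close>: the parts in
      \<open>Z\<close> and \<open>P\<close> are read off directly, the part in \<open>M\<close> by
      complementing again.\<close>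
    have "t = (t \<inter> Z) \<union> (((t \<inter> P) \<union> (M - t)) \<inter> P) \<union> (M - ((t \<inter> P) \<union> (M - t)))"
      if "t \<in> Pow J" for t
      using that N J by blast
    from this[OF st(1)] this[OF st(2)] st(3) show "s = t"
      by (metis Pair_inject)
  qed
  moreover have "?h ` {t \<in> Pow J. sum c t = a} \<subseteq> Pow Z \<times> ?U"
  proof clarsimp
    fix t assume t: "t \<subseteq> J" "a = sum c t"
    have ft: "finite t" using t assms(1) finite_subset by blast
    have "sum c t = sum c (t \<inter> Z \<union> (t \<inter> P \<union> t \<inter> M))"
      using t N J by (intro arg_cong[of _ _ "sum c"]) blast
    also have "\<dots> = sum c (t \<inter> Z) + (sum c (t \<inter> P) + sum c (t \<inter> M))"
      using ft N J by (subst sum.union_disjoint; (subst sum.union_disjoint)?) auto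
    also have "\<dots> = int (card (t \<inter> P)) - int (card (t \<inter> M))"
      by (simp add: Z_def P_def M_def)
    finally have s: "sum c t = int (card (t \<inter> P)) - int (card (t \<inter> M))" .
    have "card (t \<inter> P \<union> (M - t)) = card (t \<inter> P) + card (M - t)"
      using fin N by (intro card_Un_disjoint) auto
    moreover have "card M = card (t \<inter> M) + card (M - t)"
      using card_Int_Diff[OF fin(3), of t] by (simp add: Int_commute)
    ultimately have "card (t \<inter> P \<union> (M - t)) = nat (sum c t + int (card M))"
      using s by simp
    then show "t \<inter> P \<subseteq> N \<and> M - t \<subseteq> N \<and> card (t \<inter> P \<union> (M - t)) = nat (sum c t + int (card M))"
      using N by auto
  qed
  ultimately have "card {t \<in> Pow J. sum c t = a} \<le> card (Pow Z \<times> ?U)"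
    using fin by (intro card_inj_on_le[of ?h]) (auto intro: inj_on_subset)
  also have "\<dots> = 2 ^ card Z * (card N choose nat (a + int (card M)))"
    using fin by (simp add: card_cartesian_product card_Pow n_subsets)
  finally have "real (card {t \<in> Pow J. sum c t = a})
      \<le> real (2 ^ card Z * (card N choose nat (a + int (card M))))"
    by (rule of_nat_mono)
  also have "\<dots> \<le> 2 ^ card Z * (2 ^ card N / sqrt (real (card N) + 1))"
    using binomial_le_two_power_div_sqrt by (simp add: mult_left_mono del: times_divide_eq_right)
  also have "\<dots> = 2 ^ card J / sqrt (real (card N) + 1)"
    using J fin by (simp add: card_Un_disjoint power_add)
  finally show ?thesis unfolding N_def .
qed

section \<open>Averages over binomially distributed counts\<close>

text \<open>Absorption turns \<open>(q choose k) / (k + 1)\<close> into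
  \<open>(Suc q choose Suc k) / (q + 1)\<close>. What results is the expansion of
  \<open>(p + r) ^ (q + 1)\<close> without its term of index 0, which is nonnegative.\<close>

lemma sum_binomial_div_Suc_le:
  fixes p r :: real
  assumes "p > 0" "r \<ge> 0"
  shows "(\<Sum>k\<le>q. real (q choose k) * p ^ k * r ^ (q - k) / (real k + 1))
           \<le> (p + r) ^ (q + 1) / ((real q + 1) * p)"
proof -
  have "(real q + 1) * p * (\<Sum>k\<le>q. real (q choose k) * p ^ k * r ^ (q - k) / (real k + 1))
      = (\<Sum>k\<le>q. real (Suc q choose Suc k) * p ^ Suc k * r ^ (Suc q - Suc k))"
    unfolding sum_distrib_left
  proof (rule sum.cong[OF refl])
    fix k
    have "(real k + 1) * real (Suc q choose Suc k) = (real q + 1) * real (q choose k)"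
      using arg_cong[OF Suc_times_binomial_eq[of q k], of real]
      by (simp add: algebra_simps del: binomial_Suc_Suc)
    then have "real (Suc q choose Suc k) = (real q + 1) * real (q choose k) / (real k + 1)"
      by (simp add: field_simps del: binomial_Suc_Suc)
    then show "(real q + 1) * p * (real (q choose k) * p ^ k * r ^ (q - k) / (real k + 1))
        = real (Suc q choose Suc k) * p ^ Suc k * r ^ (Suc q - Suc k)"
      by (simp del: binomial_Suc_Suc)
  qed
  also have "\<dots> \<le> (\<Sum>k\<le>Suc q. real (Suc q choose k) * p ^ k * r ^ (Suc q - k))"
    using assms unfolding sum.atMost_Suc_shift by simp
  also have "\<dots> = (p + r) ^ (q + 1)"
    using binomial_ring[of p r "Suc q"] by simp
  finally show ?thesis
    using assms by (simp add: pos_le_divide_eq mult.commute)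
qed

text \<open>For uniform \<open>x\<close> the number of coordinates satisfying \<open>R\<close> is
  binomially distributed: group the functions by the set \<open>T\<close> of these coordinates, then
  the sets by size.\<close>

lemma sum_PiE_card_eq:
  fixes f :: "nat \<Rightarrow> real"
  assumes "finite J" "finite B"
  shows "(\<Sum>x\<in>J \<rightarrow>\<^sub>E B. f (card {j \<in> J. R (x j)})) =
         (\<Sum>k\<le>card J. real (card J choose k) * real (card {a \<in> B. R a}) ^ k
            * real (card {a \<in> B. \<not> R a}) ^ (card J - k) * f k)"
proof -
  let ?p = "real (card {a \<in> B. R a})" and ?r = "real (card {a \<in> B. \<not> R a})"
  have "(\<Sum>x\<in>J \<rightarrow>\<^sub>E B. f (card {j \<in> J. R (x j)})) =
      (\<Sum>T\<in>Pow J. \<Sum>x | x \<in> J \<rightarrow>\<^sub>E B \<and> {j \<in> J. R (x j)} = T. f (card {j \<in> J. R (x j)}))"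
    using assms by (intro sum.group[symmetric]) (auto intro: finite_PiE)
  also have "\<dots> = (\<Sum>T\<in>Pow J. ?p ^ card T * ?r ^ (card J - card T) * f (card T))"
  proof (rule sum.cong[OF refl])
    fix T assume T: "T \<in> Pow J"
    have "{x. x \<in> J \<rightarrow>\<^sub>E B \<and> {j \<in> J. R (x j)} = T}
        = (\<Pi>\<^sub>E j\<in>J. if j \<in> T then {a \<in> B. R a} else {a \<in> B. \<not> R a})"
      (is "?L = Pi\<^sub>E J ?S")
    proof (intro equalityI subsetI)
      fix x assume "x \<in> ?L"
      then show "x \<in> Pi\<^sub>E J ?S" by (auto simp: PiE_iff)
    next
      fix x assume x: "x \<in> Pi\<^sub>E J ?S"
      have "x j \<in> B \<and> (R (x j) \<longleftrightarrow> j \<in> T)" if "j \<in> J" for j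
        using PiE_mem[OF x that] by (simp split: if_splits)
      then show "x \<in> ?L" using T x by (auto simp: PiE_iff)
    qed
    moreover have "card (\<Pi>\<^sub>E j\<in>J. if j \<in> T then {a \<in> B. R a} else {a \<in> B. \<not> R a})
        = card {a \<in> B. R a} ^ card T * card {a \<in> B. \<not> R a} ^ (card J - card T)"
    proof -
      have "finite T" using T assms finite_subset by blast
      then have "(\<Prod>j\<in>J. if j \<in> T then card {a \<in> B. R a} else card {a \<in> B. \<not> R a})
          = card {a \<in> B. R a} ^ card (J \<inter> T) * card {a \<in> B. \<not> R a} ^ card (J - T)"
        using assms by (subst prod.If_cases) (auto simp: Diff_eq)
      moreover have "J \<inter> T = T" "card (J - T) = card J - card T"
        using T \<open>finite T\<close> by (auto simp: card_Diff_subset)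
      ultimately show ?thesis
        using assms by (simp add: card_PiE if_distrib)
    qed
    ultimately show "(\<Sum>x | x \<in> J \<rightarrow>\<^sub>E B \<and> {j \<in> J. R (x j)} = T. f (card {j \<in> J. R (x j)}))
        = ?p ^ card T * ?r ^ (card J - card T) * f (card T)"
      by (subst sum.cong[where h = "\<lambda>_. f (card T)", OF refl]) auto
  qed
  also have "\<dots> = (\<Sum>k\<le>card J. \<Sum>T | T \<in> Pow J \<and> card T = k. ?p ^ card T * ?r ^ (card J - card T) * f (card T))"
    using assms by (intro sum.group[symmetric]) (auto intro: card_mono)
  also have "\<dots> = (\<Sum>k\<le>card J. real (card J choose k) * ?p ^ k * ?r ^ (card J - k) * f k)"
    using assms by (intro sum.cong refl) (simp add: n_subsets)
  finally show ?thesis .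
qed

text \<open>By Cauchy--Schwarz it suffices to bound the mean of \<open>1 / (N + 1)\<close>, which has a closed form
  for binomially distributed \<open>N\<close>.\<close>

lemma sum_PiE_inverse_sqrt_le:
  assumes "finite J" "finite B" "a \<in> B" "R a"
  shows "(\<Sum>x\<in>J \<rightarrow>\<^sub>E B. 1 / sqrt (real (card {j \<in> J. R (x j)}) + 1))
           \<le> real (card B) ^ card J * sqrt (real (card B) / (real (card J) + 1))"
proof -
  let ?N = "\<lambda>x. real (card {j \<in> J. R (x j)}) + 1" and ?X = "J \<rightarrow>\<^sub>E B"
  let ?b = "real (card B)" and ?q = "card J"
  let ?p = "real (card {a \<in> B. R a})" and ?r = "real (card {a \<in> B. \<not> R a})"
  have "card {a \<in> B. R a} > 0"
    using assms by (auto simp: card_gt_0_iff)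
  then have p: "?p \<ge> 1" by simp
  have "card B = card ({a \<in> B. R a} \<union> {a \<in> B. \<not> R a})"
    by (intro arg_cong[of _ _ card]) auto
  also have "\<dots> = card {a \<in> B. R a} + card {a \<in> B. \<not> R a}"
    using assms by (intro card_Un_disjoint) auto
  finally have pr: "?p + ?r = ?b" by simp
  have "(\<Sum>x\<in>?X. 1 / ?N x) \<le> ?b ^ (?q + 1) / ((real ?q + 1) * ?p)"
    using sum_binomial_div_Suc_le[of ?p ?r ?q] p pr
      sum_PiE_card_eq[OF assms(1,2), of "\<lambda>k. 1 / (real k + 1)" R] by simp
  \<comment> \<open>The witness \<open>a\<close> enters only through \<open>?p \<ge> 1\<close>,
    which makes the bound depend on \<open>B\<close> alone.\<close>
  also have "\<dots> \<le> ?b ^ (?q + 1) / (real ?q + 1)"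
    using p by (intro divide_left_mono) auto
  finally have mean: "(\<Sum>x\<in>?X. 1 / ?N x) \<le> ?b ^ (?q + 1) / (real ?q + 1)" .
  have "(\<Sum>x\<in>?X. 1 / sqrt (?N x))\<^sup>2 = (\<Sum>x\<in>?X. 1 * (1 / sqrt (?N x)))\<^sup>2"
    by simp
  also have "\<dots> \<le> (\<Sum>x\<in>?X. 1\<^sup>2) * (\<Sum>x\<in>?X. (1 / sqrt (?N x))\<^sup>2)"
    by (rule Cauchy_Schwarz_ineq_sum)
  also have "\<dots> = ?b ^ ?q * (\<Sum>x\<in>?X. 1 / ?N x)"
    using assms by (simp add: power_divide card_PiE)
  also have "\<dots> \<le> ?b ^ ?q * (?b ^ (?q + 1) / (real ?q + 1))"
    using mean by (intro mult_left_mono) auto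
  also have "\<dots> = (?b ^ ?q * sqrt (?b / (real ?q + 1)))\<^sup>2"
    by (simp add: power_mult_distrib) (simp add: power2_eq_square)
  finally show ?thesis
    by (rule power2_le_imp_le) simp
qed

section \<open>Independence of blocks and averaging over exchanges\<close>

text \<open>Independence of the blocks: restricting to the fibres of \<open>\<kappa>\<close>
  identifies the function space with a product of function spaces, over which a product of blockwise
  factors distributes.\<close>

lemma sum_PiE_blocks:
  fixes g :: "'k \<Rightarrow> ('j \<Rightarrow> 'a) \<Rightarrow> real"
  assumes "finite J" "finite K" "finite B" and \<kappa>: "\<kappa> \<in> J \<rightarrow> K"
  shows "(\<Sum>x\<in>J \<rightarrow>\<^sub>E B. \<Prod>k\<in>K. g k (restrict x {j \<in> J. \<kappa> j = k}))
       = (\<Prod>k\<in>K. \<Sum>x\<in>{j \<in> J. \<kappa> j = k} \<rightarrow>\<^sub>E B. g k x)"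
proof -
  let ?J = "\<lambda>k. {j \<in> J. \<kappa> j = k}"
  have "(\<Prod>k\<in>K. \<Sum>x\<in>?J k \<rightarrow>\<^sub>E B. g k x) = (\<Sum>h\<in>(\<Pi>\<^sub>E k\<in>K. ?J k \<rightarrow>\<^sub>E B). \<Prod>k\<in>K. g k (h k))"
    using assms by (intro prod_sum_PiE) (auto intro: finite_PiE)
  also have "\<dots> = (\<Sum>x\<in>J \<rightarrow>\<^sub>E B. \<Prod>k\<in>K. g k (restrict x (?J k)))"
  proof (rule sum.reindex_bij_witness[where i = "\<lambda>x. \<lambda>k\<in>K. restrict x (?J k)" and
        j = "\<lambda>h. \<lambda>j\<in>J. h (\<kappa> j) j"])
    fix h assume h: "h \<in> (\<Pi>\<^sub>E k\<in>K. ?J k \<rightarrow>\<^sub>E B)"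
    \<comment> \<open>Outside the block of \<open>k\<close> both sides are \<open>undefined\<close>,
      which \<open>PiE_arb\<close> supplies for \<open>h k\<close>.\<close>
    have e: "restrict (\<lambda>j\<in>J. h (\<kappa> j) j) (?J k) = h k" if "k \<in> K" for k
    proof
      fix j show "restrict (\<lambda>j\<in>J. h (\<kappa> j) j) (?J k) j = h k j"
        using PiE_arb[OF PiE_mem[OF h that], of j] by (auto simp: restrict_def)
    qed
    then show "(\<lambda>k\<in>K. restrict (\<lambda>j\<in>J. h (\<kappa> j) j) (?J k)) = h"
      using h by (auto simp: fun_eq_iff restrict_def PiE_def extensional_def)
    show "(\<lambda>j\<in>J. h (\<kappa> j) j) \<in> J \<rightarrow>\<^sub>E B"
    proof (rule restrict_PiE_iff[THEN iffD2], rule ballI)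
      fix j assume "j \<in> J"
      then show "h (\<kappa> j) j \<in> B"
        using PiE_mem[OF PiE_mem[OF h, of "\<kappa> j"], of j] \<kappa> by auto
    qed
    show "(\<Prod>k\<in>K. g k (restrict (\<lambda>j\<in>J. h (\<kappa> j) j) (?J k))) = (\<Prod>k\<in>K. g k (h k))"
      using e by simp
  next
    fix x assume x: "x \<in> J \<rightarrow>\<^sub>E B"
    show "(\<lambda>j\<in>J. (\<lambda>k\<in>K. restrict x (?J k)) (\<kappa> j) j) = x"
      using x \<kappa> by (auto simp: fun_eq_iff restrict_def PiE_def extensional_def)
    show "(\<lambda>k\<in>K. restrict x (?J k)) \<in> (\<Pi>\<^sub>E k\<in>K. ?J k \<rightarrow>\<^sub>E B)"
      using x by (auto simp: PiE_iff)
  qed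
  finally show ?thesis ..
qed

text \<open>A subset of \<open>J\<close> is determined by its traces on the fibres of
  \<open>\<kappa>\<close>. This bounds the admissible coin outcomes block by block.\<close>

lemma card_subsets_blocks_le:
  assumes "finite J" "finite K" and \<kappa>: "\<kappa> \<in> J \<rightarrow> K"
    and S: "\<And>s k. s \<in> S \<Longrightarrow> k \<in> K \<Longrightarrow> s \<inter> {j \<in> J. \<kappa> j = k} \<in> T k"
    and "S \<subseteq> Pow J" and T: "\<And>k. k \<in> K \<Longrightarrow> finite (T k)"
  shows "card S \<le> (\<Prod>k\<in>K. card (T k))"
proof -
  let ?h = "\<lambda>s. \<lambda>k\<in>K. s \<inter> {j \<in> J. \<kappa> j = k}"
  have "inj_on ?h S"
  proof (rule inj_onI)
    fix s t assume st: "s \<in> S" "t \<in> S" "?h s = ?h t"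
    have "j \<in> s \<longleftrightarrow> j \<in> t" if "j \<in> J" for j
      using fun_cong[OF st(3), of "\<kappa> j"] funcset_mem[OF \<kappa> that] that by auto
    then show "s = t" using st(1,2) \<open>S \<subseteq> Pow J\<close> by blast
  qed
  moreover have "?h ` S \<subseteq> (\<Pi>\<^sub>E k\<in>K. T k)"
    using S by auto
  moreover have "finite (\<Pi>\<^sub>E k\<in>K. T k)"
    using assms by (intro finite_PiE) auto
  ultimately have "card S \<le> card (\<Pi>\<^sub>E k\<in>K. T k)"
    by (rule card_inj_on_le)
  then show ?thesis using assms by (simp add: card_PiE)
qed

text \<open>For each fixed \<open>s\<close>, applying the involutions at the coordinates in
  \<open>s\<close> permutes the function space, so the count of \<open>P\<close> does not change.
  Summing over all \<open>s\<close> and exchanging the sums turns the count into coin counts for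
  each fixed \<open>x\<close>.\<close>

lemma card_PiE_average_involutions:
  assumes "finite J" "finite B"
    and f: "\<And>j a. j \<in> J \<Longrightarrow> a \<in> B \<Longrightarrow> f j a \<in> B" "\<And>j a. j \<in> J \<Longrightarrow> a \<in> B \<Longrightarrow> f j (f j a) = a"
  shows "2 ^ card J * card {x \<in> J \<rightarrow>\<^sub>E B. P x}
       = (\<Sum>x\<in>J \<rightarrow>\<^sub>E B. card {s \<in> Pow J. P (\<lambda>j\<in>J. if j \<in> s then f j (x j) else x j)})"
proof -
  let ?X = "J \<rightarrow>\<^sub>E B" and ?F = "\<lambda>s x. \<lambda>j\<in>J. if j \<in> s then f j (x j) else x j"
  have fin: "finite ?X" "finite (Pow J)"
    using assms by (auto intro: finite_PiE)
  have "card {x \<in> ?X. P x} = card {x \<in> ?X. P (?F s x)}" for s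
  proof -
    define G where "G = ?F s"
    have *: "G (G x) = x" "G x \<in> ?X" if "x \<in> ?X" for x
      using that f by (auto simp: G_def fun_eq_iff PiE_iff extensional_def)
    have "bij_betw G {x \<in> ?X. P x} {x \<in> ?X. P (G x)}"
      using * by (intro bij_betw_byWitness[where f' = G]) (simp_all add: image_subset_iff)
    then show ?thesis unfolding G_def by (rule bij_betw_same_card)
  qed
  then have "2 ^ card J * card {x \<in> ?X. P x} = (\<Sum>s\<in>Pow J. card {x \<in> ?X. P (?F s x)})"
    using assms by (simp add: card_Pow)
  also have "\<dots> = (\<Sum>x\<in>?X. card {s \<in> Pow J. P (?F s x)})"
    using fin by (intro sum_multicount_gen) auto
  finally show ?thesis .
qed

text \<open>The probabilistic core in abstract form. \<open>other\<close> confines the effect on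
  \<open>\<phi> k\<close> to block \<open>k\<close>, \<open>step\<close> gives the coin sums
  coefficients in {-1, 0, 1}, and \<open>moved\<close> ensures that the number of nonzero
  coefficients is large on average.\<close>

lemma card_PiE_level_set_le:
  fixes \<phi> :: "'k \<Rightarrow> 'a \<Rightarrow> int" and t :: "'k \<Rightarrow> int"
  assumes fin: "finite J" "finite K" "finite B" and \<kappa>: "\<kappa> \<in> J \<rightarrow> K"
    and f: "\<And>k a. k \<in> K \<Longrightarrow> a \<in> B \<Longrightarrow> f k a \<in> B" "\<And>k a. k \<in> K \<Longrightarrow> a \<in> B \<Longrightarrow> f k (f k a) = a"
    and other: "\<And>k l a. k \<in> K \<Longrightarrow> l \<in> K \<Longrightarrow> k \<noteq> l \<Longrightarrow> a \<in> B \<Longrightarrow> \<phi> k (f l a) = \<phi> k a"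
    and step: "\<And>k a. k \<in> K \<Longrightarrow> a \<in> B \<Longrightarrow> \<bar>\<phi> k (f k a) - \<phi> k a\<bar> \<le> 1"
    and moved: "\<And>k. k \<in> K \<Longrightarrow> \<exists>a\<in>B. \<phi> k (f k a) \<noteq> \<phi> k a"
  shows "real (card {x \<in> J \<rightarrow>\<^sub>E B. \<forall>k\<in>K. (\<Sum>j\<in>J. \<phi> k (x j)) = t k})
    \<le> real (card B) ^ card J * (\<Prod>k\<in>K. sqrt (real (card B) / (real (card {j \<in> J. \<kappa> j = k}) + 1)))"
proof -
  let ?X = "J \<rightarrow>\<^sub>E B" and ?J = "\<lambda>k. {j \<in> J. \<kappa> j = k}"
  let ?P = "\<lambda>x. \<forall>k\<in>K. (\<Sum>j\<in>J. \<phi> k (x j)) = t k"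
  let ?F = "\<lambda>s x. \<lambda>j\<in>J. if j \<in> s then f (\<kappa> j) (x j) else x j"
  let ?c = "\<lambda>k a. \<phi> k (f k a) - \<phi> k a"
  let ?N = "\<lambda>k x. real (card {j \<in> ?J k. ?c k (x j) \<noteq> 0}) + 1"
  have cardJ: "card J = (\<Sum>k\<in>K. card (?J k))"
    using sum.group[of J K \<kappa> "\<lambda>_. 1::nat"] fin \<kappa> by (simp add: image_subset_iff_funcset)
  have orbit: "real (card {s \<in> Pow J. ?P (?F s x)}) \<le> (\<Prod>k\<in>K. 2 ^ card (?J k) * (1 / sqrt (?N k x)))"
    if x: "x \<in> ?X" for x
  proof -
    \<comment> \<open>The shift that the exchanges in block \<open>k\<close> have to produce,
      starting from \<open>x\<close>.\<close>
    let ?a = "\<lambda>k. t k - (\<Sum>j\<in>J. \<phi> k (x j))"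
    let ?T = "\<lambda>k. {u \<in> Pow (?J k). (\<Sum>j\<in>u. ?c k (x j)) = ?a k}"
    have "card {s \<in> Pow J. ?P (?F s x)} \<le> (\<Prod>k\<in>K. card (?T k))"
    proof (rule card_subsets_blocks_le[OF fin(1,2) \<kappa>])
      fix s k assume s: "s \<in> {s \<in> Pow J. ?P (?F s x)}" and k: "k \<in> K"
      have "t k = (\<Sum>j\<in>J. \<phi> k (?F s x j))" using s k by simp
      \<comment> \<open>By \<open>other\<close>, exchanges outside block \<open>k\<close> leave this
        sum unchanged.\<close>
      also have "\<dots> = (\<Sum>j\<in>J. \<phi> k (x j) + (if j \<in> s \<inter> ?J k then ?c k (x j) else 0))"
        using other[OF k] \<kappa> x by (intro sum.cong refl) (auto simp: PiE_iff Pi_iff)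
      also have "\<dots> = (\<Sum>j\<in>J. \<phi> k (x j)) + (\<Sum>j\<in>J \<inter> (s \<inter> ?J k). ?c k (x j))"
        using fin by (simp only: sum.distrib sum.inter_restrict)
      also have "J \<inter> (s \<inter> ?J k) = s \<inter> ?J k" by auto
      finally show "s \<inter> ?J k \<in> ?T k" by simp
    qed (use fin in auto)
    then have "real (card {s \<in> Pow J. ?P (?F s x)}) \<le> (\<Prod>k\<in>K. real (card (?T k)))"
      by (simp only: of_nat_prod[symmetric] of_nat_le_iff)
    also have "\<dots> \<le> (\<Prod>k\<in>K. 2 ^ card (?J k) * (1 / sqrt (?N k x)))"
    proof (intro prod_mono conjI)
      fix k assume k: "k \<in> K"
      have "\<bar>?c k (x j)\<bar> \<le> 1" if "j \<in> ?J k" for j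
        using that x k by (intro step) auto
      from card_subsets_sum_eq_le[of "?J k" "\<lambda>j. ?c k (x j)", OF _ this]
      show "real (card (?T k)) \<le> 2 ^ card (?J k) * (1 / sqrt (?N k x))"
        using fin by simp
    qed simp
    finally show ?thesis .
  qed
  have "2 ^ card J * card {x \<in> ?X. ?P x} = (\<Sum>x\<in>?X. card {s \<in> Pow J. ?P (?F s x)})"
    using fin f funcset_mem[OF \<kappa>] by (intro card_PiE_average_involutions) blast+
  from arg_cong[OF this, of real]
  have "2 ^ card J * real (card {x \<in> ?X. ?P x}) = (\<Sum>x\<in>?X. real (card {s \<in> Pow J. ?P (?F s x)}))"
    by (simp only: of_nat_mult of_nat_power of_nat_numeral of_nat_sum)
  also have "\<dots> \<le> (\<Sum>x\<in>?X. \<Prod>k\<in>K. 2 ^ card (?J k) * (1 / sqrt (?N k x)))"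
    by (intro sum_mono orbit)
  also have "\<dots> = 2 ^ card J * (\<Sum>x\<in>?X. \<Prod>k\<in>K. 1 / sqrt (?N k x))"
    by (simp only: prod.distrib sum_distrib_left cardJ power_sum)
  \<comment> \<open>Inserting \<open>restrict\<close> exhibits each factor as a function of its own
    block, the form in which the sum factorises.\<close>
  also have "(\<Sum>x\<in>?X. \<Prod>k\<in>K. 1 / sqrt (?N k x))
      = (\<Sum>x\<in>?X. \<Prod>k\<in>K. 1 / sqrt (?N k (restrict x (?J k))))"
    by (intro sum.cong prod.cong refl arg_cong[of _ _ "\<lambda>A. 1 / sqrt (real (card A) + 1)"]) auto
  also have "\<dots> = (\<Prod>k\<in>K. \<Sum>x\<in>?J k \<rightarrow>\<^sub>E B. 1 / sqrt (?N k x))"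
    using fin \<kappa> by (rule sum_PiE_blocks)
  also have "\<dots> \<le> (\<Prod>k\<in>K. real (card B) ^ card (?J k) * sqrt (real (card B) / (real (card (?J k)) + 1)))"
  proof (intro prod_mono conjI)
    fix k assume k: "k \<in> K"
    then obtain a where "a \<in> B" "?c k a \<noteq> 0" using moved by fastforce
    then show "(\<Sum>x\<in>?J k \<rightarrow>\<^sub>E B. 1 / sqrt (?N k x))
        \<le> real (card B) ^ card (?J k) * sqrt (real (card B) / (real (card (?J k)) + 1))"
      using fin by (intro sum_PiE_inverse_sqrt_le[where R = "\<lambda>a. ?c k a \<noteq> 0"]) auto
  qed (auto intro: sum_nonneg)
  also have "\<dots> = real (card B) ^ card J * (\<Prod>k\<in>K. sqrt (real (card B) / (real (card (?J k)) + 1)))"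
    by (simp add: prod.distrib cardJ power_sum)
  finally show ?thesis by simp
qed

section \<open>Half-size column supports and prefix counts\<close>

text \<open>Exchanging \<open>l\<close> and \<open>Suc l\<close> preserves the prefix
  \<open>{..k}\<close> unless \<open>l = k\<close>, since otherwise both or neither lie in it. For
  \<open>l = k\<close> just one position crosses the boundary in each direction. This decouples the
  prefix counts.\<close>

lemma card_transpose_image_Int_atMost:
  fixes A :: "nat set"
  shows "k \<noteq> l \<Longrightarrow> card (Transposition.transpose l (Suc l) ` A \<inter> {..k}) = card (A \<inter> {..k})"
    and "int (card (Transposition.transpose k (Suc k) ` A \<inter> {..k}))
           = int (card (A \<inter> {..k})) + of_bool (Suc k \<in> A) - of_bool (k \<in> A)"
proof -
  assume "k \<noteq> l"
  then have "Transposition.transpose l (Suc l) ` {..k} = {..k}"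
    by (force simp: Transposition.transpose_def image_iff)
  then have "Transposition.transpose l (Suc l) ` A \<inter> {..k} = Transposition.transpose l (Suc l) ` (A \<inter> {..k})"
    by (metis image_Int inj_transpose)
  then show "card (Transposition.transpose l (Suc l) ` A \<inter> {..k}) = card (A \<inter> {..k})"
    by (simp add: card_image inj_on_subset[OF inj_transpose])
next
  have "Transposition.transpose k (Suc k) ` A \<inter> {..k} = (if Suc k \<in> A then insert k (A \<inter> {..<k}) else A \<inter> {..<k})"
    by (force simp: Transposition.transpose_def image_iff)
  moreover have "A \<inter> {..k} = (if k \<in> A then insert k (A \<inter> {..<k}) else A \<inter> {..<k})"
    by (auto simp: le_less)
  ultimately show "int (card (Transposition.transpose k (Suc k) ` A \<inter> {..k}))
      = int (card (A \<inter> {..k})) + of_bool (Suc k \<in> A) - of_bool (k \<in> A)"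
    by simp
qed

lemma sum_signs_eq_card:
  fixes f :: "'a \<Rightarrow> int"
  assumes "finite A" "\<And>i. i \<in> A \<Longrightarrow> f i \<in> {1, -1}"
  shows "sum f A = 2 * int (card {i \<in> A. f i = 1}) - int (card A)"
proof -
  have "sum f A = (\<Sum>i\<in>A. 2 * of_bool (f i = 1) - 1)"
    using assms by (intro sum.cong) auto
  also have "\<dots> = 2 * (\<Sum>i\<in>A. of_bool (f i = 1)) - int (card A)"
    by (simp add: sum_subtractf sum_distrib_left)
  finally show ?thesis
    using assms by (simp add: sum_of_bool_eq Int_def)
qed

text \<open>A matrix is encoded by the sets of rows holding +1 in each column. Row balance is passed
  on in cumulative form, over proper prefixes of the rows; the prefix of all rows is already fixed
  by the column sizes, which leaves \<open>m - 1\<close> conditions.\<close>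

lemma alpha_even_le:
  assumes "even m" "even n"
  shows "alpha m n \<le> card {x \<in> {..<n} \<rightarrow>\<^sub>E {A. A \<subseteq> {..<m} \<and> card A = m div 2}.
    \<forall>k\<in>{..<m - 1}. (\<Sum>j<n. int (card (x j \<inter> {..k}))) = int ((k + 1) * (n div 2))}"
    (is "_ \<le> card ?Y")
proof -
  let ?h = "\<lambda>M :: int mat. \<lambda>j\<in>{..<n}. {i. i < m \<and> M $$ (i, j) = 1}"
  \<comment> \<open>A sum of an even number of signs is even, so absolute value at most 1 forces it
    to vanish.\<close>
  have half: "card {i \<in> I. f i = 1} = card I div 2"
    if "finite I" "\<And>i. i \<in> I \<Longrightarrow> f i \<in> {1, -1}" "\<bar>sum f I\<bar> \<le> 1" "even (card I)"
    for I :: "nat set" and f :: "nat \<Rightarrow> int"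
    using sum_signs_eq_card[of I f] that by presburger
  have "inj_on ?h (near_balanced_mats m n)"
  proof (rule inj_onI)
    fix M M' assume M: "M \<in> near_balanced_mats m n" "M' \<in> near_balanced_mats m n" "?h M = ?h M'"
    show "M = M'"
    proof (rule eq_matI)
      fix i j assume "i < dim_row M'" "j < dim_col M'"
      then have ij: "i < m" "j < n" using M by (auto simp: near_balanced_mats_def)
      have "M $$ (i, j) = 1 \<longleftrightarrow> M' $$ (i, j) = 1"
        using fun_cong[OF M(3), of j] ij by auto
      moreover have "M $$ (i, j) \<in> {1, -1}" "M' $$ (i, j) \<in> {1, -1}"
        using M(1,2) ij by (auto simp: near_balanced_mats_def)
      ultimately show "M $$ (i, j) = M' $$ (i, j)" by auto
    qed (use M in \<open>auto simp: near_balanced_mats_def\<close>)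
  qed
  moreover have "?h ` near_balanced_mats m n \<subseteq> ?Y"
  proof clarify
    fix M assume M: "M \<in> near_balanced_mats m n"
    have row: "card {j \<in> {..<n}. M $$ (i, j) = 1} = n div 2" if "i < m" for i
      using half[of "{..<n}" "\<lambda>j. M $$ (i, j)"] M that assms by (auto simp: near_balanced_mats_def)
    have col: "card {i \<in> {..<m}. M $$ (i, j) = 1} = m div 2" if "j < n" for j
      using half[of "{..<m}" "\<lambda>i. M $$ (i, j)"] M that assms by (auto simp: near_balanced_mats_def)
    have "(\<Sum>j<n. card (?h M j \<inter> {..k})) = (k + 1) * (n div 2)" if "k < m - 1" for k
    proof -
      have "(\<Sum>j<n. card (?h M j \<inter> {..k})) = (\<Sum>j<n. card {i \<in> {..k}. M $$ (i, j) = 1})"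
        using that by (intro sum.cong refl arg_cong[of _ _ card]) auto
      also have "\<dots> = (\<Sum>i\<le>k. card {j \<in> {..<n}. M $$ (i, j) = 1})"
        by (intro sum_multicount_gen) auto
      also have "\<dots> = (k + 1) * (n div 2)"
        using row that by simp
      finally show ?thesis .
    qed
    then show "?h M \<in> ({..<n} \<rightarrow>\<^sub>E {A. A \<subseteq> {..<m} \<and> card A = m div 2}) \<and>
        (\<forall>k\<in>{..<m - 1}. (\<Sum>j<n. int (card (?h M j \<inter> {..k}))) = int ((k + 1) * (n div 2)))"
      using col by (auto simp flip: of_nat_sum)
  qed
  moreover have "finite ?Y"
    by (rule finite_subset[of _ "{..<n} \<rightarrow>\<^sub>E Pow {..<m}"]) (auto intro: finite_PiE)
  ultimately show ?thesis
    unfolding alpha_def by (intro card_inj_on_le)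
qed

text \<open>The class contains \<open>i * d + k\<close> for every \<open>i < n div d\<close>. The
  added 1 absorbs the rounding and is the same 1 that stands under the square root in the level set
  bound.\<close>

lemma card_residue_class_ge:
  assumes "k < d"
  shows "real n / real d \<le> real (card {j \<in> {..<n}. j mod d = k}) + 1"
proof -
  have "card {..<n div d} \<le> card {j \<in> {..<n}. j mod d = k}"
  proof (rule card_inj_on_le[where f = "\<lambda>i. i * d + k"])
    show "inj_on (\<lambda>i. i * d + k) {..<n div d}"
      using assms by (auto simp: inj_on_def)
    show "(\<lambda>i. i * d + k) ` {..<n div d} \<subseteq> {j \<in> {..<n}. j mod d = k}"
    proof (use assms in clarsimp)
      fix i assume "i < n div d"
      then have "Suc i * d \<le> n div d * d" by (intro mult_right_mono) auto
      also have "\<dots> \<le> n" by simp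
      finally show "i * d + k < n" using assms by simp
    qed
  qed simp
  moreover have "n \<le> d * (n div d + 1)"
    using assms dividend_less_times_div[of d n] by simp
  then have "real n \<le> real d * (real (n div d) + 1)"
    by (metis of_nat_1 of_nat_add of_nat_le_iff of_nat_mult)
  ultimately show ?thesis
    using assms by (simp add: field_simps) (smt (verit) mult_left_mono of_nat_0_le_iff of_nat_mono)
qed

section \<open>The asymptotic bound with an explicit constant\<close>

theorem theorem9:
  fixes m :: nat
  assumes "even m" and "m > 0"
  shows "\<exists>C\<^sub>2::real. C\<^sub>2 > 0 \<and>
           (\<exists>N::nat. \<forall>n\<ge>N. even n \<longrightarrow>
              real (alpha m n) \<le>
                C\<^sub>2 * (real (m choose (m div 2)) ^ n / real n powr ((real m - 1) / 2)))"
proof -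
  define B where "B = {A. A \<subseteq> {..<m} \<and> card A = m div 2}"
  define d where "d = m - 1"
  define b where "b = card B"
  let ?f = "\<lambda>k A. Transposition.transpose k (Suc k) ` A" and ?\<phi> = "\<lambda>k A. int (card (A \<inter> {..k}))"
  have m: "m \<ge> 2" and d: "d > 0" and m_d: "real m - 1 = real d"
    using assms by (auto simp: d_def elim!: evenE)
  have finB: "finite B"
    by (rule finite_subset[of _ "Pow {..<m}"]) (auto simp: B_def)
  have b: "b = m choose (m div 2)"
    using n_subsets[of "{..<m}" "m div 2"] by (simp add: b_def B_def)
  have b_pos: "b > 0"
    unfolding b by (rule zero_less_binomial) simp
  have f_B: "?f k A \<in> B" if "k \<in> {..<d}" "A \<in> B" for k A
  proof -
    have "Transposition.transpose k (Suc k) ` {..<m} = {..<m}"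
      using that by (intro transpose_image_eq) (auto simp: d_def)
    moreover have "card (?f k A) = card A"
      by (simp add: card_image inj_on_subset[OF inj_transpose])
    ultimately show ?thesis
      using that by (auto simp: B_def)
  qed
  have f_f: "?f k (?f k A) = A" for k A
    by (simp add: image_image)
  \<comment> \<open>The witness contains \<open>k\<close> but not \<open>Suc k\<close>, so the
    exchange pushes one element out of the prefix. The \<open>m - 2\<close> other rows suffice to
    fill it up to size \<open>m div 2\<close>.\<close>
  have moved: "\<exists>A\<in>B. ?\<phi> k (?f k A) \<noteq> ?\<phi> k A" if "k \<in> {..<d}" for k
  proof -
    have "card ({..<m} - {k, Suc k}) = m - 2"
      using that by (subst card_Diff_subset) (auto simp: d_def)
    then have "m div 2 - 1 \<le> card ({..<m} - {k, Suc k})" using m by linarith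
    then obtain A where A: "A \<subseteq> {..<m} - {k, Suc k}" "card A = m div 2 - 1" "finite A"
      by (meson obtain_subset_with_card_n)
    then have "card (insert k A) = Suc (m div 2 - 1)" by (subst card_insert_disjoint) auto
    also have "\<dots> = m div 2" using m by linarith
    finally have "insert k A \<in> B" using A that by (auto simp: B_def d_def)
    moreover have "?\<phi> k (?f k (insert k A)) \<noteq> ?\<phi> k (insert k A)"
      unfolding card_transpose_image_Int_atMost(2) using A by auto
    ultimately show ?thesis by blast
  qed
  \<comment> \<open>Each of the \<open>d\<close> residue classes contributes at most
    \<open>sqrt (b * d / n)\<close>; the part free of \<open>n\<close> in their product is the
    constant. The estimate holds from \<open>n = 1\<close> on.\<close>
  have bound: "real (alpha m n) \<le>
      (real b * real d) powr (real d / 2) * (real (m choose (m div 2)) ^ n / real n powr ((real m - 1) / 2))"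
    if n: "n \<ge> 1" "even n" for n
  proof -
    have "real (alpha m n) \<le> real (card {x \<in> {..<n} \<rightarrow>\<^sub>E B.
        \<forall>k\<in>{..<d}. (\<Sum>j<n. ?\<phi> k (x j)) = int ((k + 1) * (n div 2))})"
      using alpha_even_le[OF assms(1) n(2)] unfolding B_def d_def by (simp only: of_nat_le_iff)
    also have "\<dots> \<le> real (card B) ^ card {..<n} *
        (\<Prod>k\<in>{..<d}. sqrt (real (card B) / (real (card {j \<in> {..<n}. j mod d = k}) + 1)))"
    proof (rule card_PiE_level_set_le[where f = ?f])
      show "\<bar>?\<phi> k (?f k A) - ?\<phi> k A\<bar> \<le> 1" for k A
        unfolding card_transpose_image_Int_atMost(2) by simp
    qed (use finB d f_B f_f moved card_transpose_image_Int_atMost(1) in auto)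
    also have "\<dots> \<le> real b ^ n * (\<Prod>k\<in>{..<d}. sqrt (real b * real d / real n))"
    proof -
      have "sqrt (real b / (real (card {j \<in> {..<n}. j mod d = k}) + 1)) \<le> sqrt (real b * real d / real n)"
        if "k < d" for k
      proof -
        have "real b / (real (card {j \<in> {..<n}. j mod d = k}) + 1) \<le> real b / (real n / real d)"
          using card_residue_class_ge[OF that, of n] n d by (intro divide_left_mono) auto
        then show ?thesis by simp
      qed
      then show ?thesis
        unfolding b_def[symmetric] card_lessThan
        by (intro mult_left_mono prod_mono conjI) (simp_all del: real_sqrt_le_iff)
    qed
    also have "(\<Prod>k\<in>{..<d}. sqrt (real b * real d / real n)) = (real b * real d / real n) powr (real d / 2)"
      using b_pos d n by (simp add: powr_half_sqrt[symmetric] powr_realpow[symmetric] powr_powr)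
    also have "\<dots> = (real b * real d) powr (real d / 2) / real n powr (real d / 2)"
      by (simp add: powr_divide)
    finally show ?thesis
      unfolding b m_d by (simp add: mult_ac)
  qed
  show ?thesis
    using bound b_pos d by (intro exI[of _ "(real b * real d) powr (real d / 2)"] conjI exI[of _ 1]) auto
qed

end
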